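(* Consider the 1D BGK equation $\partial_tf+v\,\partial_xf=\frac1\varepsilon(M[f]-f)$ with velocity domain truncated to a large enough symmetric interval $[-|v|_{\max},|v|_{\max}]$, periodic or compactly supported boundary condition in $x$, and the convection term discretized on a uniform grid by the first-order upwind scheme $$(v\partial_xf)_k=\chi_{v\ge0}\,v\,\frac{f_k-f_{k-1}}{\Delta x}+\chi_{v<0}\,v\,\frac{f_{k+1}-f_k}{\Delta x}.$$ Let $f^{n+1}$ be obtained from $f^n\ge 0$ by $$f_k^{(i)} = f_k^n - \Delta t\sum_{j=1}^{i-1}\tilde a_{ij}(v\partial_xf^{(j)})_k + \Delta t\sum_{j=1}^i \frac{a_{ij}}{\varepsilon}(M[f_k^{(j)}]-f_k^{(j)}),\quad i=1,\dots,\nu,$$ $$f_k^{n+1}=f_k^{(\nu)}+\frac{\alpha\Delta t^2}{\varepsilon^2}(M[f_k^{n+1}]-f_k^{n+1}),$$ where $\alpha\ge0$ and the scheme is GSA and either of type A satisfying the type A positivity conditions or of type ARS satisfying the type ARS positivity conditions. If the CFL condition $\Delta t\le c_{\mathrm{sch}}\,\Delta x/|v|_{\max}$ holds, then the discrete entropy inequality $$S[f^{n+1}]\le S[f^n]$$ holds, where $S[f]=\Delta x\sum_kS[f_k]$, $S[f_k]=\int s[f_k]\,dv$, $s[f_k]=f_k\log f_k$.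
   Context: $f_k=f_k(v)$, where $k$ is the spatial grid index and $v\in[-|v|_{\max},|v|_{\max}]$ is kept continuous; $0\log0=0$. $M[f]=\frac{\rho}{\sqrt{2\pi T}}\exp(-\frac{(v-u)^2}{2T})$ with $\rho=\int f\,dv$, $u=\frac1\rho\int fv\,dv$, $T=\frac1\rho\int f(v-u)^2\,dv$. The velocity interval is large enough that truncation effects are neglected; in particular $\int M[f]\phi\,dv=\int f\phi\,dv$ for $\phi=(1,v,v^2/2)^T$. All densities and temperatures are positive. **Coefficients.** $\tilde a_{ij}=0$ for $j\ge i$ and $a_{ij}=0$ for $j>i$. GSA (globally stiffly accurate): the weights of the tableau coincide with the last rows, $w_i=a_{\nu i}$, $\tilde w_i=\tilde a_{\nu i}$. Type A: $A=(a_{ij})$ invertible. Type ARS: the first row and first column of $A$ vanish, $(a_{ij})_{i,j=2}^\nu$ is invertible, $w_1=0$ (so $f^{(1)}=f^n$). **Type A positivity conditions.** Put, for $1\le j<i\le \nu$, recursively $$b_{ii}=\frac1{a_{ii}},\quad b_{ij}=-\frac1{a_{ii}}\sum_{l=j}^{i-1}a_{il}b_{lj},\quad \tilde b_{ij}=\frac1{a_{ii}}\Big(-\tilde a_{ij}-\sum_{l=j+1}^{i-1}a_{il}\tilde b_{lj}\Big),$$ $$c_{i0}=1-\sum_{j=1}^{i-1}\sum_{l=j}^{i-1}a_{il}b_{lj},\quad c_{ij}=\sum_{l=j}^{i-1}a_{il}b_{lj},\quad \tilde c_{ij}=\tilde a_{ij}+\sum_{l=j+1}^{i-1}a_{il}\tilde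 b_{lj}.$$ The conditions are: $a_{ii}>0$, $c_{i0}\ge0$ for $i=1,\dots,\nu$; $c_{ij}\ge0$, $\tilde c_{ij}\ge0$ for $i=2,\dots,\nu$, $j=1,\dots,i-1$. In this case $c_{\mathrm{sch}}=\min_{2\le i\le\nu,\,1\le j\le i-1}\{c_{ij}/\tilde c_{ij}\}$. **Type ARS positivity conditions.** With $b_{ij}$ ($2\le j\le i$) and $\tilde b_{ij}$ ($1\le j<i$, $i\ge2$) given by the same formulas for $i=2,\dots,\nu$, put $$c_{i0}=1-\sum_{j=2}^{i-1}\sum_{l=j}^{i-1}a_{il}b_{lj},\quad \tilde c_{i0}=\tilde a_{i1}+\sum_{j=2}^{i-1}a_{ij}\tilde b_{j1},\quad c_{ij}=\sum_{l=j}^{i-1}a_{il}b_{lj},\quad \tilde c_{ij}=\tilde a_{ij}+\sum_{l=j+1}^{i-1}a_{il}\tilde b_{lj}.$$ The conditions are: $a_{ii}>0$, $c_{i0}\ge0$, $\tilde c_{i0}\ge0$ for $i=2,\dots,\nu$; $c_{ij}\ge0$, $\tilde c_{ij}\ge0$ for $i=3,\dots,\nu$, $j=2,\dots,i-1$. In this case $c_{\mathrm{sch}}=\min\big\{\min_{2\le i\le\nu}c_{i0}/\tilde c_{i0},\ \min_{3\le i\le\nu,\,2\le j\le i-1}c_{ij}/\tilde c_{ij}\big\}$. A ratio with zero denominator is read as $+\infty$.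
   Formalization: On a bounded velocity interval M[f] with ρ,u,T the moments of f there cannot have the same moments as f. Here M[f] is the Gaussian whose moments of 1, v, v²/2 on the interval equal those of f, assumed to exist for the stages and f^{n+1}; zero density in empty cells is allowed. *)

theory Defs
  imports "HOL-Probability.Probability" "Jordan_Normal_Form.Matrix"
begin

(* Grid functions have type int => real => real: spatial index first, velocity second.  Only
   their values for velocities in {-V..V} matter.  Tableau indices are 1-based naturals. *)

subsection \<open>The local Maxwellian\<close>

definition maxwellian :: "real \<Rightarrow> real \<Rightarrow> real \<Rightarrow> real \<Rightarrow> real" where
  "maxwellian \<rho> u T v = \<rho> / sqrt (2 * pi * T) * exp (- (v - u)\<^sup>2 / (2 * T))"

definition collision_invariants :: "(real \<Rightarrow> real) set" where
  "collision_invariants = {\<lambda>v. 1, \<lambda>v. v, \<lambda>v. v\<^sup>2 / 2}"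

(* On a bounded velocity domain D, a Gaussian whose parameters are the exact D-moments of f never
   has the same moments as f on D (its mass on D is already less than rho).  "Truncation effects
   are neglected, so that M[f] and f have the same moments" is therefore expressed by taking as
   M[f] the Gaussian whose moments on D are those of f; on a bounded interval it is unique
   (local_maxwellian_eq), and on the whole line it is the usual explicit formula
   (local_maxwellian_UNIV).  The value rho = 0 is admitted only to give M[0] = 0 in the empty
   cells of a compactly supported grid function. *)
definition maxwellian_moments :: "real set \<Rightarrow> (real \<Rightarrow> real) \<Rightarrow> real \<times> real \<times> real \<Rightarrow> bool" where
  "maxwellian_moments D f = (\<lambda>(\<rho>, u, T). \<rho> \<ge> 0 \<and> T > 0 \<and>
     (\<forall>\<phi>\<in>collision_invariants.
        (LINT v:D|lborel. maxwellian \<rho> u T v * \<phi> v) = (LINT v:D|lborel. f v * \<phi> v)))"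

definition has_maxwellian :: "real set \<Rightarrow> (real \<Rightarrow> real) \<Rightarrow> bool" where
  "has_maxwellian D f \<longleftrightarrow> (\<exists>p. maxwellian_moments D f p)"

definition local_maxwellian :: "real set \<Rightarrow> (real \<Rightarrow> real) \<Rightarrow> real \<Rightarrow> real" where
  "local_maxwellian D f = (case SOME p. maxwellian_moments D f p of (\<rho>, u, T) \<Rightarrow> maxwellian \<rho> u T)"

lemma maxwellian_normal_density:
  "T > 0 \<Longrightarrow> maxwellian \<rho> u T v = \<rho> * normal_density u (sqrt T) v"
  by (simp add: maxwellian_def normal_density_def)

lemma continuous_maxwellian: "T > 0 \<Longrightarrow> continuous_on S (maxwellian \<rho> u T)"
  unfolding maxwellian_def by (intro continuous_intros) auto

lemma maxwellian_moments_unique: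
  assumes V: "V > 0" and m1: "maxwellian_moments {-V..V} f (\<rho>1, u1, T1)"
    and m2: "maxwellian_moments {-V..V} f (\<rho>2, u2, T2)" and v: "v \<in> {-V..V}"
  shows "maxwellian \<rho>1 u1 T1 v = maxwellian \<rho>2 u2 T2 v"
proof -
  let ?g1 = "maxwellian \<rho>1 u1 T1" and ?g2 = "maxwellian \<rho>2 u2 T2"
  let ?D = "{-V..V}"
  have T: "T1 > 0" "T2 > 0" and r: "\<rho>1 \<ge> 0" "\<rho>2 \<ge> 0"
    using m1 m2 by (auto simp: maxwellian_moments_def)
  have cont: "continuous_on ?D ?g1" "continuous_on ?D ?g2"
    using T by (auto intro: continuous_maxwellian)
  have conv: "(LINT w:?D|lborel. h w) = integral ?D h" if "continuous_on ?D h" for h :: "real \<Rightarrow> real"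
    using borel_integrable_atLeastAtMost'[OF that] by (rule set_borel_integral_eq_integral(2))
  have phi_cont: "continuous_on ?D \<phi>" if "\<phi> \<in> collision_invariants" for \<phi>
    using that unfolding collision_invariants_def by (auto intro!: continuous_intros)
  have eq: "integral ?D (\<lambda>w. ?g1 w * \<phi> w) = integral ?D (\<lambda>w. ?g2 w * \<phi> w)"
    if "\<phi> \<in> collision_invariants" for \<phi>
  proof -
    have "(LINT w:?D|lborel. ?g1 w * \<phi> w) = (LINT w:?D|lborel. ?g2 w * \<phi> w)"
      using m1 m2 that by (auto simp: maxwellian_moments_def)
    then show ?thesis
      using conv[OF continuous_on_mult[OF cont(1) phi_cont[OF that]]]
        conv[OF continuous_on_mult[OF cont(2) phi_cont[OF that]]] by simp
  qed
  have zero: "integral ?D (\<lambda>w. (?g1 w - ?g2 w) * \<phi> w) = 0" if "\<phi> \<in> collision_invariants" for \<phi>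
  proof -
    have "(\<lambda>w. ?g1 w * \<phi> w) integrable_on ?D" "(\<lambda>w. ?g2 w * \<phi> w) integrable_on ?D"
      using cont phi_cont[OF that] by (auto intro!: integrable_continuous_interval continuous_intros)
    then show ?thesis
      using eq[OF that] by (simp add: left_diff_distrib integral_diff)
  qed
  have vanish: "h w = 0" if "continuous_on ?D h" "\<And>w. w \<in> ?D \<Longrightarrow> h w \<ge> 0" "integral ?D h = 0" "w \<in> ?D"
    for h :: "real \<Rightarrow> real" and w
    using integral_eq_0_iff[of "-V" V h] that V by auto
  have mass0: "\<rho> = 0" if "T > 0" "\<rho> \<ge> 0" "integral ?D (maxwellian \<rho> u T) = 0" for \<rho> u T
  proof -
    have "maxwellian \<rho> u T 0 = 0"
    proof (rule vanish[of "maxwellian \<rho> u T" 0])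
      show "continuous_on ?D (maxwellian \<rho> u T)" using that by (intro continuous_maxwellian)
      show "integral ?D (maxwellian \<rho> u T) = 0" by (rule that)
    qed (use that V in \<open>auto simp: maxwellian_def\<close>)
    then show ?thesis using that by (simp add: maxwellian_def)
  qed
  have mass: "integral ?D ?g1 = integral ?D ?g2"
    using eq[of "\<lambda>v. 1"] by (simp add: collision_invariants_def)
  show ?thesis
  proof (cases "\<rho>1 = 0 \<or> \<rho>2 = 0")
    case True
    then have "\<rho>1 = 0 \<and> \<rho>2 = 0"
    proof
      assume "\<rho>1 = 0"
      then have "integral ?D ?g1 = 0" by (simp add: maxwellian_def [abs_def])
      then show ?thesis using mass0[OF T(2) r(2)] mass \<open>\<rho>1 = 0\<close> by simp
    next
      assume "\<rho>2 = 0"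
      then have "integral ?D ?g2 = 0" by (simp add: maxwellian_def [abs_def])
      then show ?thesis using mass0[OF T(1) r(1)] mass \<open>\<rho>2 = 0\<close> by simp
    qed
    then show ?thesis by (simp add: maxwellian_def)
  next
    case False
    then have r': "\<rho>1 > 0" "\<rho>2 > 0" using r by auto
    have pos: "?g1 w > 0" "?g2 w > 0" for w using r' T by (auto simp: maxwellian_def)
    have lng: "ln (maxwellian \<rho> u T w) = ln (\<rho> / sqrt (2 * pi * T)) - (w - u)\<^sup>2 / (2 * T)"
      if "\<rho> > 0" "T > 0" for \<rho> u T w
    proof -
      have "\<rho> / sqrt (2 * pi * T) > 0" using that by simp
      then show ?thesis unfolding maxwellian_def by (subst ln_mult_pos) auto
    qed
    define a where "a = ln (\<rho>1 / sqrt (2 * pi * T1)) - ln (\<rho>2 / sqrt (2 * pi * T2))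
                         - u1\<^sup>2 / (2 * T1) + u2\<^sup>2 / (2 * T2)"
    define b where "b = u1 / T1 - u2 / T2"
    define c where "c = 1 / T2 - 1 / T1"
    have quad: "ln (?g1 w) - ln (?g2 w) = a + b * w + c * (w\<^sup>2 / 2)" for w
      unfolding lng[OF r'(1) T(1)] lng[OF r'(2) T(2)] a_def b_def c_def using T
      by (simp add: power2_diff diff_divide_distrib add_divide_distrib left_diff_distrib right_diff_distrib mult.commute)
    define h where "h = (\<lambda>w. (?g1 w - ?g2 w) * (ln (?g1 w) - ln (?g2 w)))"
    have hq: "h = (\<lambda>w. a * ((?g1 w - ?g2 w) * 1) + b * ((?g1 w - ?g2 w) * w)
                        + c * ((?g1 w - ?g2 w) * (w\<^sup>2 / 2)))"
      unfolding h_def quad by (auto simp: algebra_simps diff_divide_distrib)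
    have int: "(\<lambda>w. k * ((?g1 w - ?g2 w) * \<phi> w)) integrable_on ?D"
      if "\<phi> \<in> collision_invariants" for k \<phi>
      using cont phi_cont[OF that] by (intro integrable_continuous_interval continuous_intros)
    have ci: "(\<lambda>v. 1) \<in> collision_invariants" "(\<lambda>v. v) \<in> collision_invariants"
        "(\<lambda>v. v\<^sup>2 / 2) \<in> collision_invariants"
      by (auto simp: collision_invariants_def)
    have "integral ?D h = 0"
      unfolding hq
      by (subst integral_add[OF integrable_add[OF int[OF ci(1)] int[OF ci(2)]] int[OF ci(3)]],
          subst integral_add[OF int[OF ci(1)] int[OF ci(2)]],
          simp only: integral_mult_right zero[OF ci(1)] zero[OF ci(2)] zero[OF ci(3)])
    moreover have "continuous_on ?D h"
      unfolding h_def using cont pos by (intro continuous_intros) (auto simp: less_imp_neq[symmetric])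
    moreover have "h w \<ge> 0" for w
      unfolding h_def using pos[of w] by (cases "?g1 w \<ge> ?g2 w") (auto intro: mult_nonneg_nonneg mult_nonpos_nonpos)
    ultimately have "h v = 0" using v by (intro vanish[of h v])
    then show ?thesis using pos[of v] by (auto simp: h_def)
  qed
qed

lemma local_maxwellian_eq:
  assumes "V > 0" "maxwellian_moments {-V..V} f (\<rho>, u, T)" "v \<in> {-V..V}"
  shows "local_maxwellian {-V..V} f v = maxwellian \<rho> u T v"
proof -
  obtain \<rho>' u' T' where p: "(SOME p. maxwellian_moments {-V..V} f p) = (\<rho>', u', T')"
    by (metis prod_cases3)
  have "maxwellian_moments {-V..V} f (\<rho>', u', T')"
    using assms(2) p by (metis someI)
  then show ?thesis
    using maxwellian_moments_unique[OF assms(1) _ assms(2,3)] p by (simp add: local_maxwellian_def)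
qed

lemma maxwellian_moments_UNIV:
  assumes "T > 0"
  shows "(LINT v|lborel. maxwellian \<rho> u T v) = \<rho>"
    and "(LINT v|lborel. maxwellian \<rho> u T v * v) = \<rho> * u"
    and "(LINT v|lborel. maxwellian \<rho> u T v * v\<^sup>2) = \<rho> * (T + u\<^sup>2)"
proof -
  let ?n = "normal_density u (sqrt T)"
  have s: "0 < sqrt T" using assms by simp
  show "(LINT v|lborel. maxwellian \<rho> u T v) = \<rho>"
    using s by (simp add: maxwellian_normal_density[OF assms])
  show "(LINT v|lborel. maxwellian \<rho> u T v * v) = \<rho> * u"
    using integral_normal_moment_nz_1[OF s, of u]
    by (simp add: maxwellian_normal_density[OF assms] mult.assoc)
  have "(LINT v|lborel. ?n v * v\<^sup>2)
      = (LINT v|lborel. ?n v * (v - u)^(2*1) + ((2 * u) * (?n v * v) - u\<^sup>2 * ?n v))"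
    by (rule Bochner_Integration.integral_cong) (auto simp: power2_eq_square algebra_simps)
  also have "\<dots> = (LINT v|lborel. ?n v * (v - u)^(2*1))
      + ((LINT v|lborel. (2 * u) * (?n v * v)) - (LINT v|lborel. u\<^sup>2 * ?n v))"
    using integrable_normal_moment[OF s, of u 2] integrable_normal_moment_nz_1[OF s, of u]
      integrable_normal_density[OF s, of u] by simp
  also have "\<dots> = T + u\<^sup>2"
    using assms s integral_normal_moment_even[OF s, of u 1] integral_normal_moment_nz_1[OF s, of u]
    by (simp add: power2_eq_square)
  finally show "(LINT v|lborel. maxwellian \<rho> u T v * v\<^sup>2) = \<rho> * (T + u\<^sup>2)"
    by (simp add: maxwellian_normal_density[OF assms] mult.assoc)
qed

lemma local_maxwellian_UNIV:
  fixes f :: "real \<Rightarrow> real"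
  assumes int: "integrable lborel f" "integrable lborel (\<lambda>v. f v * v)"
      "integrable lborel (\<lambda>v. f v * v\<^sup>2)"
    and \<rho>: "\<rho> = (LINT v|lborel. f v)" and u: "u = (LINT v|lborel. f v * v) / \<rho>"
    and T: "T = (LINT v|lborel. f v * (v - u)\<^sup>2) / \<rho>"
    and pos: "\<rho> > 0" "T > 0"
  shows "has_maxwellian UNIV f" and "local_maxwellian UNIV f = maxwellian \<rho> u T"
proof -
  have m1: "(LINT v|lborel. f v * v) = \<rho> * u" using u pos by simp
  have "(LINT v|lborel. f v * (v - u)\<^sup>2)
      = (LINT v|lborel. f v * v\<^sup>2 - ((2 * u) * (f v * v) - u\<^sup>2 * f v))"
    by (rule Bochner_Integration.integral_cong) (auto simp: power2_eq_square algebra_simps)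
  also have "\<dots> = (LINT v|lborel. f v * v\<^sup>2)
      - ((LINT v|lborel. (2 * u) * (f v * v)) - (LINT v|lborel. u\<^sup>2 * f v))"
    using int by simp
  also have "\<dots> = (LINT v|lborel. f v * v\<^sup>2) - \<rho> * u\<^sup>2"
    using m1 \<rho> by (simp add: power2_eq_square)
  finally have m2: "(LINT v|lborel. f v * v\<^sup>2) = \<rho> * (T + u\<^sup>2)"
    using T pos by (simp add: field_simps)
  have iff: "maxwellian_moments UNIV f (r, w, t) \<longleftrightarrow>
      r \<ge> 0 \<and> t > 0 \<and> r = \<rho> \<and> r * w = \<rho> * u \<and> r * (t + w\<^sup>2) = \<rho> * (T + u\<^sup>2)" for r w t
    using maxwellian_moments_UNIV[of t r w] m1 m2 \<rho>
    by (auto simp: maxwellian_moments_def collision_invariants_def set_lebesgue_integral_def)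
  have eq: "maxwellian_moments UNIV f p \<longleftrightarrow> p = (\<rho>, u, T)" for p
  proof (cases p)
    case (fields r w t)
    then show ?thesis using iff[of r w t] pos by auto
  qed
  show "has_maxwellian UNIV f" by (simp add: has_maxwellian_def eq)
  show "local_maxwellian UNIV f = maxwellian \<rho> u T" by (simp add: local_maxwellian_def eq)
qed

subsection \<open>Spatial grid and entropy\<close>

datatype boundary = Periodic nat | Compact_support

primrec satisfies_bc :: "boundary \<Rightarrow> real \<Rightarrow> (int \<Rightarrow> real \<Rightarrow> real) \<Rightarrow> bool" where
  "satisfies_bc (Periodic N) V f \<longleftrightarrow> N > 0 \<and> (\<forall>k. \<forall>v\<in>{-V..V}. f (k + int N) v = f k v)"
| "satisfies_bc Compact_support V f \<longleftrightarrow> finite {k. \<exists>v\<in>{-V..V}. f k v \<noteq> 0}"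

(* The cells that contribute to the sum over the spatial grid: one period, or the support. *)
primrec cells :: "boundary \<Rightarrow> real \<Rightarrow> (int \<Rightarrow> real \<Rightarrow> real) \<Rightarrow> int set" where
  "cells (Periodic N) V f = {0..<int N}"
| "cells Compact_support V f = {k. \<exists>v\<in>{-V..V}. f k v \<noteq> 0}"

definition ent_density :: "real \<Rightarrow> real" where
  "ent_density y = (if y = 0 then 0 else y * ln y)"

definition local_entropy :: "real \<Rightarrow> (real \<Rightarrow> real) \<Rightarrow> real" where
  "local_entropy V g = (LINT v:{-V..V}|lborel. ent_density (g v))"

definition total_entropy :: "boundary \<Rightarrow> real \<Rightarrow> real \<Rightarrow> (int \<Rightarrow> real \<Rightarrow> real) \<Rightarrow> real" where
  "total_entropy bc V dx f = dx * (\<Sum>k\<in>cells bc V f. local_entropy V (f k))"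

subsection \<open>The scheme\<close>

definition upwind :: "real \<Rightarrow> (int \<Rightarrow> real \<Rightarrow> real) \<Rightarrow> int \<Rightarrow> real \<Rightarrow> real" where
  "upwind dx f k v = (if v \<ge> 0 then v * ((f k v - f (k - 1) v) / dx)
                      else v * ((f (k + 1) v - f k v) / dx))"

definition imex_bgk_step ::
  "nat \<Rightarrow> (nat \<Rightarrow> nat \<Rightarrow> real) \<Rightarrow> (nat \<Rightarrow> nat \<Rightarrow> real) \<Rightarrow> real \<Rightarrow> real \<Rightarrow> real \<Rightarrow> real \<Rightarrow> real \<Rightarrow>
   (int \<Rightarrow> real \<Rightarrow> real) \<Rightarrow> (nat \<Rightarrow> int \<Rightarrow> real \<Rightarrow> real) \<Rightarrow> (int \<Rightarrow> real \<Rightarrow> real) \<Rightarrow> bool" where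
  "imex_bgk_step \<nu> a a' \<alpha> \<epsilon> dt dx V fn F fn1 \<longleftrightarrow>
     (\<forall>i\<in>{1..\<nu>}. \<forall>k. \<forall>v\<in>{-V..V}.
        F i k v = fn k v - dt * (\<Sum>j\<in>{1..<i}. a' i j * upwind dx (F j) k v)
          + dt * (\<Sum>j\<in>{1..i}. a i j / \<epsilon> * (local_maxwellian {-V..V} (F j k) v - F j k v))) \<and>
     (\<forall>k. \<forall>v\<in>{-V..V}.
        fn1 k v = F \<nu> k v + \<alpha> * dt\<^sup>2 / \<epsilon>\<^sup>2 * (local_maxwellian {-V..V} (fn1 k) v - fn1 k v))"

subsection \<open>Tableaux; \<open>a'\<close> and \<open>w'\<close> stand for the explicit coefficients\<close>

definition imex_tableau :: "nat \<Rightarrow> (nat \<Rightarrow> nat \<Rightarrow> real) \<Rightarrow> (nat \<Rightarrow> nat \<Rightarrow> real) \<Rightarrow> bool" where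
  "imex_tableau \<nu> a a' \<longleftrightarrow> (\<forall>i\<in>{1..\<nu>}. \<forall>j\<in>{1..\<nu>}.
     (j \<ge> i \<longrightarrow> a' i j = 0) \<and> (j > i \<longrightarrow> a i j = 0))"

definition gsa ::
  "nat \<Rightarrow> (nat \<Rightarrow> nat \<Rightarrow> real) \<Rightarrow> (nat \<Rightarrow> real) \<Rightarrow> (nat \<Rightarrow> nat \<Rightarrow> real) \<Rightarrow> (nat \<Rightarrow> real) \<Rightarrow> bool" where
  "gsa \<nu> a w a' w' \<longleftrightarrow> (\<forall>i\<in>{1..\<nu>}. w i = a \<nu> i \<and> w' i = a' \<nu> i)"

definition type_A :: "nat \<Rightarrow> (nat \<Rightarrow> nat \<Rightarrow> real) \<Rightarrow> bool" where
  "type_A \<nu> a \<longleftrightarrow> invertible_mat (Matrix.mat \<nu> \<nu> (\<lambda>(i, j). a (i + 1) (j + 1)))"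

definition type_ARS :: "nat \<Rightarrow> (nat \<Rightarrow> nat \<Rightarrow> real) \<Rightarrow> (nat \<Rightarrow> real) \<Rightarrow> bool" where
  "type_ARS \<nu> a w \<longleftrightarrow> (\<forall>j\<in>{1..\<nu>}. a 1 j = 0) \<and> (\<forall>i\<in>{1..\<nu>}. a i 1 = 0) \<and> w 1 = 0 \<and>
     invertible_mat (Matrix.mat (\<nu> - 1) (\<nu> - 1) (\<lambda>(i, j). a (i + 2) (j + 2)))"

fun coef_b :: "(nat \<Rightarrow> nat \<Rightarrow> real) \<Rightarrow> nat \<Rightarrow> nat \<Rightarrow> real" where
  "coef_b a i j = (if i = j then 1 / a i i
     else if j < i then - (1 / a i i) * (\<Sum>l\<in>{j..<i}. a i l * coef_b a l j)
     else 0)"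

fun coef_b' :: "(nat \<Rightarrow> nat \<Rightarrow> real) \<Rightarrow> (nat \<Rightarrow> nat \<Rightarrow> real) \<Rightarrow> nat \<Rightarrow> nat \<Rightarrow> real" where
  "coef_b' a a' i j = (if j < i
     then 1 / a i i * (- a' i j - (\<Sum>l\<in>{j<..<i}. a i l * coef_b' a a' l j))
     else 0)"

declare coef_b.simps [simp del] coef_b'.simps [simp del]

definition coef_c :: "(nat \<Rightarrow> nat \<Rightarrow> real) \<Rightarrow> nat \<Rightarrow> nat \<Rightarrow> real" where
  "coef_c a i j = (\<Sum>l\<in>{j..<i}. a i l * coef_b a l j)"

definition coef_c' :: "(nat \<Rightarrow> nat \<Rightarrow> real) \<Rightarrow> (nat \<Rightarrow> nat \<Rightarrow> real) \<Rightarrow> nat \<Rightarrow> nat \<Rightarrow> real" where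
  "coef_c' a a' i j = a' i j + (\<Sum>l\<in>{j<..<i}. a i l * coef_b' a a' l j)"

definition coef_c0_A :: "(nat \<Rightarrow> nat \<Rightarrow> real) \<Rightarrow> nat \<Rightarrow> real" where
  "coef_c0_A a i = 1 - (\<Sum>j\<in>{1..<i}. \<Sum>l\<in>{j..<i}. a i l * coef_b a l j)"

definition coef_c0_ARS :: "(nat \<Rightarrow> nat \<Rightarrow> real) \<Rightarrow> nat \<Rightarrow> real" where
  "coef_c0_ARS a i = 1 - (\<Sum>j\<in>{2..<i}. \<Sum>l\<in>{j..<i}. a i l * coef_b a l j)"

definition coef_c0'_ARS :: "(nat \<Rightarrow> nat \<Rightarrow> real) \<Rightarrow> (nat \<Rightarrow> nat \<Rightarrow> real) \<Rightarrow> nat \<Rightarrow> real" where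
  "coef_c0'_ARS a a' i = a' i 1 + (\<Sum>j\<in>{2..<i}. a i j * coef_b' a a' j 1)"

definition positivity_A :: "nat \<Rightarrow> (nat \<Rightarrow> nat \<Rightarrow> real) \<Rightarrow> (nat \<Rightarrow> nat \<Rightarrow> real) \<Rightarrow> bool" where
  "positivity_A \<nu> a a' \<longleftrightarrow> (\<forall>i\<in>{1..\<nu>}. a i i > 0 \<and> coef_c0_A a i \<ge> 0) \<and>
     (\<forall>i\<in>{2..\<nu>}. \<forall>j\<in>{1..<i}. coef_c a i j \<ge> 0 \<and> coef_c' a a' i j \<ge> 0)"

definition positivity_ARS :: "nat \<Rightarrow> (nat \<Rightarrow> nat \<Rightarrow> real) \<Rightarrow> (nat \<Rightarrow> nat \<Rightarrow> real) \<Rightarrow> bool" where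
  "positivity_ARS \<nu> a a' \<longleftrightarrow>
     (\<forall>i\<in>{2..\<nu>}. a i i > 0 \<and> coef_c0_ARS a i \<ge> 0 \<and> coef_c0'_ARS a a' i \<ge> 0) \<and>
     (\<forall>i\<in>{3..\<nu>}. \<forall>j\<in>{2..<i}. coef_c a i j \<ge> 0 \<and> coef_c' a a' i j \<ge> 0)"

definition ratio :: "real \<Rightarrow> real \<Rightarrow> ereal" where
  "ratio x y = (if y = 0 then \<infinity> else ereal (x / y))"

(* INF rather than Min, so that a minimum over an empty index set is infinite (no restriction). *)
definition c_sch_A :: "nat \<Rightarrow> (nat \<Rightarrow> nat \<Rightarrow> real) \<Rightarrow> (nat \<Rightarrow> nat \<Rightarrow> real) \<Rightarrow> ereal" where
  "c_sch_A \<nu> a a' = (INF i\<in>{2..\<nu>}. INF j\<in>{1..<i}. ratio (coef_c a i j) (coef_c' a a' i j))"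

definition c_sch_ARS :: "nat \<Rightarrow> (nat \<Rightarrow> nat \<Rightarrow> real) \<Rightarrow> (nat \<Rightarrow> nat \<Rightarrow> real) \<Rightarrow> ereal" where
  "c_sch_ARS \<nu> a a' = min (INF i\<in>{2..\<nu>}. ratio (coef_c0_ARS a i) (coef_c0'_ARS a a' i))
     (INF i\<in>{3..\<nu>}. INF j\<in>{2..<i}. ratio (coef_c a i j) (coef_c' a a' i j))"

end

theory Submission
  imports Defs
begin

text \<open>
  Solving the implicit relations for the collision terms of the earlier stages and inserting them
  into stage \<open>i\<close> turns it into
  \<open>F i = G i + l i * (M[F i] - F i)\<close>, where \<open>l i = a i i * dt / \<epsilon>\<close> and \<open>G i\<close> is a linear combination
  of \<open>fn\<close> and of explicit Euler upwind steps
  \<open>F j - (c' i j / c i j) * dt * (v * dF j / dx)\<close> with \<open>j < i\<close>, whose weights \<open>c i 0\<close> and \<open>c i j\<close> sum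
  to one (\<open>stage_elimination\<close>).  The positivity conditions make the weights nonnegative, and the CFL
  condition says exactly that each upwind step has CFL number at most one.  For an ARS tableau the
  first stage is \<open>fn\<close> itself, and an upwind step of it takes over the weight of \<open>fn\<close>.

  Neither ingredient increases the entropy.  An upwind step with CFL number at most one
  replaces each value by a convex combination of neighbouring values; by Jensen's inequality for
  \<open>y * ln y\<close>, and since the sum over the grid is invariant under shifts, the total
  entropy does not increase (\<open>upwind_entropy\<close>).  Forming \<open>G i\<close> is Jensen's inequality once more.
  For the implicit relaxation, \<open>F = (G + l * M) / (1 + l)\<close> is a convex combination as well, so
  \<open>(1 + l) * S[F] \<le> S[G] + l * S[M]\<close>; the Maxwellian minimises the entropy among profiles with its
  moments, so \<open>S[M] \<le> S[F]\<close>, and \<open>S[F] \<le> S[G]\<close> follows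
  (\<open>maxwellian_minimizes_entropy\<close>, \<open>relaxation_entropy\<close>).  This holds for any \<open>l \<ge> 0\<close>, which also
  covers the final correction with \<open>l = \<alpha> * dt\<^sup>2 / \<epsilon>\<^sup>2\<close>.  Induction on the stages
  (\<open>convex_stages_entropy\<close>) gives the theorem.  Nonnegativity, measurability and
  finiteness of the entropy travel along the same induction, bundled in the predicate \<open>entropic\<close>.
\<close>

section \<open>The entropy density\<close>

text \<open>
  The graph of \<open>y * ln y\<close> lies above its tangents.  Jensen's inequality and the minimality of the
  Maxwellian are both read off from this; \<open>y = 0\<close> needs its own argument because the logarithm
  is undefined there.
\<close>

lemma ent_density_tangent:
  assumes "y \<ge> 0" "m > 0"
  shows "ent_density m + (1 + ln m) * (y - m) \<le> ent_density y"
proof (cases "y = 0")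
  case True
  then show ?thesis using assms by (simp add: ent_density_def algebra_simps)
next
  case False
  then have y: "y > 0" using assms by simp
  have "ln (m / y) \<le> m / y - 1" using y assms by (intro ln_le_minus_one) simp
  then have "y * ln (m / y) \<le> y * (m / y - 1)" using y by (intro mult_left_mono) auto
  then have "y * (ln m - ln y) \<le> m - y"
    using y assms by (simp add: ln_div right_diff_distrib)
  then show ?thesis using y assms by (simp add: ent_density_def algebra_simps)
qed

text \<open>
  The tangent at \<open>1\<close>: it bounds the entropy density below, and a profile by its entropy density, so
  that finite entropy implies finite mass.
\<close>

lemma ent_density_lower: "y \<ge> 0 \<Longrightarrow> y \<le> ent_density y + 1"
  using ent_density_tangent[of y 1] by (simp add: ent_density_def)

lemma ent_density_0 [simp]: "ent_density 0 = 0"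
  by (simp add: ent_density_def)

lemma ent_density_jensen:
  assumes "finite I" and w: "\<And>i. i \<in> I \<Longrightarrow> w i \<ge> 0" and x: "\<And>i. i \<in> I \<Longrightarrow> x i \<ge> 0"
    and one: "sum w I = 1"
  shows "ent_density (\<Sum>i\<in>I. w i * x i) \<le> (\<Sum>i\<in>I. w i * ent_density (x i))"
proof -
  \<comment> \<open>Average the tangent inequalities at the mean \<open>m\<close>: the linear part cancels.\<close>
  define m where "m = (\<Sum>i\<in>I. w i * x i)"
  have "m \<ge> 0" unfolding m_def using w x by (intro sum_nonneg) simp
  show ?thesis
  proof (cases "m = 0")
    case True
    then have "w i * x i = 0" if "i \<in> I" for i
      using sum_nonneg_eq_0_iff[OF \<open>finite I\<close>, of "\<lambda>i. w i * x i"] w x that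
      unfolding m_def by simp
    then have "w i * ent_density (x i) = 0" if "i \<in> I" for i
      using that by fastforce
    then have "(\<Sum>i\<in>I. w i * ent_density (x i)) = 0" by (intro sum.neutral) blast
    then show ?thesis using True by (simp add: m_def)
  next
    case False
    then have m: "m > 0" using \<open>m \<ge> 0\<close> by simp
    \<comment> \<open>The second summand vanishes; it is written down so that it can be distributed over the sum.\<close>
    have "ent_density m = (\<Sum>i\<in>I. w i * ent_density m) + (1 + ln m) * (m - sum w I * m)"
      by (simp add: sum_distrib_right[symmetric] one)
    also have "\<dots> = (\<Sum>i\<in>I. w i * (ent_density m + (1 + ln m) * (x i - m)))"
      by (simp add: m_def[symmetric] algebra_simps sum.distrib sum_subtractf
            sum_distrib_left[symmetric] sum_distrib_right[symmetric])
    also have "\<dots> \<le> (\<Sum>i\<in>I. w i * ent_density (x i))"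
      using m w x by (intro sum_mono mult_left_mono ent_density_tangent) auto
    finally show ?thesis unfolding m_def .
  qed
qed

lemma borel_measurable_ent_density [measurable]: "ent_density \<in> borel_measurable borel"
  unfolding ent_density_def by measurable

section \<open>Velocity profiles with finite entropy\<close>

definition entropic :: "real \<Rightarrow> (real \<Rightarrow> real) \<Rightarrow> bool" where
  "entropic V h \<longleftrightarrow> set_borel_measurable lborel {-V..V} h \<and> (\<forall>v\<in>{-V..V}. h v \<ge> 0) \<and>
     set_integrable lborel {-V..V} (\<lambda>v. ent_density (h v))"

lemma set_borel_measurable_ent_density:
  assumes "set_borel_measurable lborel A h"
  shows "set_borel_measurable lborel A (\<lambda>v. ent_density (h v))"
proof -
  have "(\<lambda>v. ent_density (indicator A v *\<^sub>R h v)) \<in> borel_measurable lborel"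
    using assms unfolding set_borel_measurable_def by measurable
  moreover have "ent_density (indicator A v *\<^sub>R h v) = indicator A v *\<^sub>R ent_density (h v)" for v
    by (simp split: split_indicator)
  ultimately show ?thesis by (simp add: set_borel_measurable_def)
qed

lemma set_integrable_const_interval:
  "set_integrable lborel {-V..V::real} (\<lambda>v. c::real)"
  by (rule borel_integrable_atLeastAtMost') simp

lemma set_integrable_bounded_mult:
  fixes h w :: "real \<Rightarrow> real"
  assumes h: "set_integrable lborel A h" and w: "w \<in> borel_measurable borel"
    and bound: "\<And>v. v \<in> A \<Longrightarrow> \<bar>w v\<bar> \<le> B"
  shows "set_integrable lborel A (\<lambda>v. w v * h v)"
proof (rule set_integrable_bound[where f = "\<lambda>v. B * h v"])
  show "set_integrable lborel A (\<lambda>v. B * h v)" using h by simp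
  have "(\<lambda>v. indicator A v *\<^sub>R h v) \<in> borel_measurable lborel"
    using h unfolding set_integrable_def by (rule borel_measurable_integrable)
  then have "(\<lambda>v. w v * (indicator A v *\<^sub>R h v)) \<in> borel_measurable lborel"
    using w by measurable
  then show "set_borel_measurable lborel A (\<lambda>v. w v * h v)"
    by (simp add: set_borel_measurable_def ac_simps)
  show "AE v in lborel. v \<in> A \<longrightarrow> norm (w v * h v) \<le> norm (B * h v)"
  proof (intro AE_I2 impI)
    fix v assume "v \<in> A"
    then have "\<bar>w v\<bar> \<le> \<bar>B\<bar>" using bound[of v] by linarith
    then show "norm (w v * h v) \<le> norm (B * h v)"
      unfolding norm_mult by (intro mult_right_mono) auto
  qed
qed

lemma set_integral_sum:
  fixes f :: "'i \<Rightarrow> real \<Rightarrow> real"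
  assumes "\<And>i. i \<in> I \<Longrightarrow> set_integrable lborel A (f i)"
  shows "set_integrable lborel A (\<lambda>v. \<Sum>i\<in>I. f i v)"
    and "(LINT v:A|lborel. (\<Sum>i\<in>I. f i v)) = (\<Sum>i\<in>I. LINT v:A|lborel. f i v)"
proof -
  have *: "integrable lborel (\<lambda>v. indicator A v *\<^sub>R f i v)" if "i \<in> I" for i
    using assms[OF that] unfolding set_integrable_def .
  show "set_integrable lborel A (\<lambda>v. \<Sum>i\<in>I. f i v)"
    unfolding set_integrable_def scaleR_sum_right
    by (rule Bochner_Integration.integrable_sum[OF *])
  show "(LINT v:A|lborel. (\<Sum>i\<in>I. f i v)) = (\<Sum>i\<in>I. LINT v:A|lborel. f i v)"
    unfolding set_lebesgue_integral_def scaleR_sum_right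
    by (rule Bochner_Integration.integral_sum[OF *])
qed

lemma entropic_integrable:
  assumes "entropic V h"
  shows "set_integrable lborel {-V..V} h"
proof (rule set_integrable_bound[where f = "\<lambda>v. ent_density (h v) + 1"])
  show "set_integrable lborel {-V..V} (\<lambda>v. ent_density (h v) + 1)"
    using assms set_integrable_const_interval unfolding entropic_def by (intro set_integral_add) auto
  show "set_borel_measurable lborel {-V..V} h" using assms by (simp add: entropic_def)
  show "AE v in lborel. v \<in> {-V..V} \<longrightarrow> norm (h v) \<le> norm (ent_density (h v) + 1)"
    using assms ent_density_lower unfolding entropic_def by (intro AE_I2) fastforce
qed

text \<open>
  The weights may depend on the velocity because the CFL number of an upwind step is proportional
  to \<open>v\<close>.  The right-hand side of the entropy bound keeps the weights inside the
  integrals: for an upwind step they can be removed only after summation over the grid.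
\<close>

lemma entropic_convex_combination:
  assumes I: "finite I" and h: "\<And>i. i \<in> I \<Longrightarrow> entropic V (h i)"
    and w_meas: "\<And>i. i \<in> I \<Longrightarrow> w i \<in> borel_measurable borel"
    and w: "\<And>i v. i \<in> I \<Longrightarrow> v \<in> {-V..V} \<Longrightarrow> w i v \<ge> 0"
    and one: "\<And>v. v \<in> {-V..V} \<Longrightarrow> (\<Sum>i\<in>I. w i v) = 1"
    and g: "\<And>v. v \<in> {-V..V} \<Longrightarrow> g v = (\<Sum>i\<in>I. w i v * h i v)"
  shows "entropic V g"
    and "\<And>i. i \<in> I \<Longrightarrow> set_integrable lborel {-V..V} (\<lambda>v. w i v * ent_density (h i v))"
    and "local_entropy V g \<le> (\<Sum>i\<in>I. LINT v:{-V..V}|lborel. w i v * ent_density (h i v))"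
proof -
  let ?D = "{-V..V}"
  have nonneg: "h i v \<ge> 0" if "i \<in> I" "v \<in> ?D" for i v
    using h that by (auto simp: entropic_def)
  have w1: "w i v \<le> 1" if "i \<in> I" "v \<in> ?D" for i v
    using member_le_sum[of i I "\<lambda>i. w i v"] that I w one by auto
  show int: "set_integrable lborel ?D (\<lambda>v. w i v * ent_density (h i v))" if "i \<in> I" for i
    using that h w1 w w_meas
    by (intro set_integrable_bounded_mult[where B = 1]) (auto simp: entropic_def)
  note intS = set_integral_sum[where I = I and f = "\<lambda>i v. w i v * ent_density (h i v)", OF int]
  have "(\<lambda>v. \<Sum>i\<in>I. w i v * (indicator ?D v *\<^sub>R h i v)) \<in> borel_measurable lborel"
    using h w_meas unfolding entropic_def set_borel_measurable_def
    by (intro borel_measurable_sum borel_measurable_times) auto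
  also have "(\<lambda>v. \<Sum>i\<in>I. w i v * (indicator ?D v *\<^sub>R h i v)) = (\<lambda>v. indicator ?D v *\<^sub>R g v)"
    using g by (auto simp: fun_eq_iff split: split_indicator)
  finally have meas: "set_borel_measurable lborel ?D g"
    unfolding set_borel_measurable_def .
  have g0: "g v \<ge> 0" if "v \<in> ?D" for v
    using that nonneg w by (auto simp: g intro!: sum_nonneg)
  have le: "ent_density (g v) \<le> (\<Sum>i\<in>I. w i v * ent_density (h i v))" if "v \<in> ?D" for v
    unfolding g[OF that] using that I w nonneg one by (intro ent_density_jensen) auto
  \<comment> \<open>Jensen bounds the entropy density from above, the tangent at \<open>1\<close> by \<open>-1\<close> from below.\<close>
  have bnd: "set_integrable lborel ?D (\<lambda>v. 1 + \<bar>\<Sum>i\<in>I. w i v * ent_density (h i v)\<bar>)"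
    using intS(1) by (intro set_integral_add set_integrable_const_interval set_integrable_abs) auto
  have ent: "set_integrable lborel ?D (\<lambda>v. ent_density (g v))"
  proof (rule set_integrable_bound[OF bnd set_borel_measurable_ent_density[OF meas]])
    have "\<bar>ent_density (g v)\<bar> \<le> 1 + \<bar>\<Sum>i\<in>I. w i v * ent_density (h i v)\<bar>" if "v \<in> ?D" for v
      using le[OF that] ent_density_lower[OF g0[OF that]] g0[OF that] by linarith
    then show "AE v in lborel. v \<in> ?D \<longrightarrow> norm (ent_density (g v))
        \<le> norm (1 + \<bar>\<Sum>i\<in>I. w i v * ent_density (h i v)\<bar>)"
      by (intro AE_I2) auto
  qed
  show "entropic V g" using meas g0 ent by (auto simp: entropic_def)
  show "local_entropy V g \<le> (\<Sum>i\<in>I. LINT v:?D|lborel. w i v * ent_density (h i v))"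
    using set_integral_mono[OF ent intS(1) le] intS(2) by (simp add: local_entropy_def)
qed

lemma entropic_constant_combination:
  assumes I: "finite I" and h: "\<And>i. i \<in> I \<Longrightarrow> entropic V (h i)"
    and w: "\<And>i. i \<in> I \<Longrightarrow> w i \<ge> 0" and one: "sum w I = 1"
    and g: "\<And>v. v \<in> {-V..V} \<Longrightarrow> g v = (\<Sum>i\<in>I. w i * h i v)"
  shows "entropic V g" and "local_entropy V g \<le> (\<Sum>i\<in>I. w i * local_entropy V (h i))"
  using entropic_convex_combination[where I = I and V = V and h = h and w = "\<lambda>i v. w i" and g = g] assms
  by (simp_all add: local_entropy_def)

section \<open>Relaxation towards the local Maxwellian\<close>

lemma entropic_maxwellian:
  assumes "\<rho> \<ge> 0" "T > 0"
  shows "entropic V (maxwellian \<rho> u T)"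
proof -
  let ?D = "{-V..V}" and ?M = "maxwellian \<rho> u T"
  have nn: "?M v \<ge> 0" for v using assms by (simp add: maxwellian_def)
  have sqi: "set_integrable lborel ?D (\<lambda>v. ?M v)" "set_integrable lborel ?D (\<lambda>v. 1 + (?M v)\<^sup>2)"
    using assms by (auto intro!: borel_integrable_atLeastAtMost' continuous_intros continuous_maxwellian)
  have meas: "set_borel_measurable lborel ?D ?M"
    using sqi(1) unfolding set_integrable_def set_borel_measurable_def
    by (rule borel_measurable_integrable)
  have "\<bar>ent_density y\<bar> \<le> 1 + y\<^sup>2" if "y \<ge> 0" for y
  proof (cases "y = 0")
    case False
    then have "y * ln y \<le> y * (y - 1)" using that by (intro mult_left_mono ln_le_minus_one) auto
    also have "\<dots> \<le> 1 + y\<^sup>2" using that by (simp add: power2_eq_square algebra_simps)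
    finally have "ent_density y \<le> 1 + y\<^sup>2" using False by (simp add: ent_density_def)
    moreover have "- ent_density y \<le> 1 + y\<^sup>2"
      using ent_density_lower[OF that] that zero_le_power2[of y] by linarith
    ultimately show ?thesis by linarith
  qed simp
  then have "set_integrable lborel ?D (\<lambda>v. ent_density (?M v))"
    using nn by (intro set_integrable_bound[OF sqi(2) set_borel_measurable_ent_density[OF meas]] AE_I2) force
  then show ?thesis using meas nn by (simp add: entropic_def)
qed

lemma ln_maxwellian:
  assumes "\<rho> > 0" "T > 0"
  shows "ln (maxwellian \<rho> u T v) = (ln (\<rho> / sqrt (2 * pi * T)) - u\<^sup>2 / (2 * T))
    + (u / T) * v + (- 1 / T) * (v\<^sup>2 / 2)"
proof -
  have "\<rho> / sqrt (2 * pi * T) > 0" using assms by simp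
  then have "ln (maxwellian \<rho> u T v) = ln (\<rho> / sqrt (2 * pi * T)) - (v - u)\<^sup>2 / (2 * T)"
    unfolding maxwellian_def by (subst ln_mult_pos) auto
  also have "\<dots> = (ln (\<rho> / sqrt (2 * pi * T)) - u\<^sup>2 / (2 * T)) + (u / T) * v + (- 1 / T) * (v\<^sup>2 / 2)"
    using assms by (simp add: field_simps power2_eq_square)
  finally show ?thesis .
qed

text \<open>
  The tangent inequality at \<open>M\<close> bounds \<open>S[h] - S[M]\<close> below by the integral of
  \<open>(1 + ln M) * (h - M)\<close>.  Since \<open>ln M\<close> is a quadratic polynomial, it is a combination of the collision
  invariants, and this integral vanishes.  For \<open>\<rho> = 0\<close> the logarithm is not available, but then \<open>h\<close>
  has mass zero and vanishes almost everywhere.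
\<close>

lemma maxwellian_minimizes_entropy:
  assumes h: "entropic V h" and mom: "maxwellian_moments {-V..V} h (\<rho>, u, T)"
  shows "local_entropy V (maxwellian \<rho> u T) \<le> local_entropy V h"
proof -
  let ?D = "{-V..V}" and ?M = "maxwellian \<rho> u T"
  have \<rho>: "\<rho> \<ge> 0" and T: "T > 0"
    and eq: "\<And>\<phi>. \<phi> \<in> collision_invariants \<Longrightarrow>
      (LINT v:?D|lborel. ?M v * \<phi> v) = (LINT v:?D|lborel. h v * \<phi> v)"
    using mom by (auto simp: maxwellian_moments_def)
  have ci: "(\<lambda>v. 1) \<in> collision_invariants" "(\<lambda>v. v) \<in> collision_invariants"
      "(\<lambda>v. v\<^sup>2 / 2) \<in> collision_invariants"
    by (auto simp: collision_invariants_def)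
  have hint: "set_integrable lborel ?D h" by (rule entropic_integrable[OF h])
  have M: "entropic V ?M" by (rule entropic_maxwellian[OF \<rho> T])
  have Mint: "set_integrable lborel ?D ?M" by (rule entropic_integrable[OF M])
  show ?thesis
  proof (cases "\<rho> = 0")
    case True
    then have M0: "?M = (\<lambda>v. 0)" by (simp add: maxwellian_def fun_eq_iff)
    have "(LINT v:?D|lborel. h v) = 0" using eq[OF ci(1)] by (simp add: M0)
    then have "AE v in lborel. indicator ?D v *\<^sub>R h v = 0"
      using integral_nonneg_eq_0_iff_AE[of lborel "\<lambda>v. indicator ?D v *\<^sub>R h v"] hint h
      by (auto simp: set_integrable_def set_lebesgue_integral_def entropic_def split: split_indicator)
    then have "AE v in lborel. indicator ?D v *\<^sub>R ent_density (h v) = 0"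
      by eventually_elim (auto split: split_indicator_asm)
    then have "local_entropy V h = 0"
      unfolding local_entropy_def set_lebesgue_integral_def by (rule integral_eq_zero_AE)
    then show ?thesis by (simp add: M0 local_entropy_def)
  next
    case False
    then have pos: "?M v > 0" for v using \<rho> T by (simp add: maxwellian_def)
    define a where "a = 1 + (ln (\<rho> / sqrt (2 * pi * T)) - u\<^sup>2 / (2 * T))"
    define q where "q = (\<lambda>v. a * 1 + (u / T) * v + (- 1 / T) * (v\<^sup>2 / 2))"
    have q: "1 + ln (?M v) = q v" for v
      using False \<rho> T by (simp add: ln_maxwellian a_def q_def)
    have phi_int: "set_integrable lborel ?D (\<lambda>v. g v * \<phi> v)"
      if g: "set_integrable lborel ?D g" and \<phi>: "\<phi> \<in> collision_invariants" for g \<phi>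
    proof -
      have "\<bar>\<phi> v\<bar> \<le> 1 + \<bar>V\<bar> + V\<^sup>2" if "v \<in> ?D" for v
      proof -
        have "\<bar>v\<bar> \<le> \<bar>V\<bar>" using that by auto
        moreover from this have "v\<^sup>2 \<le> V\<^sup>2" by (simp only: abs_le_square_iff)
        moreover have "\<bar>\<phi> v\<bar> \<le> 1 + \<bar>v\<bar> + v\<^sup>2"
          using \<phi> by (auto simp: collision_invariants_def)
        ultimately show ?thesis by linarith
      qed
      moreover have "\<phi> \<in> borel_measurable borel"
        using \<phi> by (auto simp: collision_invariants_def)
      ultimately show ?thesis
        using set_integrable_bounded_mult[OF g, of \<phi> "1 + \<bar>V\<bar> + V\<^sup>2"]
        by (simp only: mult.commute[of "g _"])
    qed
    let ?d = "\<lambda>v. h v - ?M v"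
    have dint: "set_integrable lborel ?D ?d" using hint Mint by (rule set_integral_diff)
    have d0: "(LINT v:?D|lborel. ?d v * \<phi> v) = 0" if "\<phi> \<in> collision_invariants" for \<phi>
      using eq[OF that] set_integral_diff(2)[OF phi_int[OF hint that] phi_int[OF Mint that]]
      by (simp add: left_diff_distrib)
    have qd: "(\<lambda>v. q v * ?d v) = (\<lambda>v. a * (?d v * 1) + (u / T) * (?d v * v) + (- 1 / T) * (?d v * (v\<^sup>2 / 2)))"
    proof -
      have "(a * 1 + b * v + c * x) * y = a * (y * 1) + b * (y * v) + c * (y * x)" for b c v x y :: real
        by (simp add: algebra_simps)
      then show ?thesis unfolding q_def by blast
    qed
    have i: "set_integrable lborel ?D (\<lambda>v. k * (?d v * \<phi> v))" if "\<phi> \<in> collision_invariants" for k \<phi>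
      using phi_int[OF dint that] by simp
    have z: "(LINT v:?D|lborel. k * (?d v * \<phi> v)) = 0" if "\<phi> \<in> collision_invariants" for k \<phi>
      using d0[OF that] by simp
    note i12 = set_integral_add[OF i[OF ci(1)] i[OF ci(2)]]
    note i123 = set_integral_add[OF i12(1) i[OF ci(3)]]
    have qint: "set_integrable lborel ?D (\<lambda>v. q v * ?d v)"
      unfolding qd by (rule i123(1))
    have q0: "(LINT v:?D|lborel. q v * ?d v) = 0"
      unfolding qd by (subst i123(2), subst i12(2), simp only: z[OF ci(1)] z[OF ci(2)] z[OF ci(3)])
    have Ment: "set_integrable lborel ?D (\<lambda>v. ent_density (?M v))"
      and hent: "set_integrable lborel ?D (\<lambda>v. ent_density (h v))"
      using M h by (auto simp: entropic_def)
    note sum = set_integral_add[OF Ment qint]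
    have "local_entropy V ?M = (LINT v:?D|lborel. ent_density (?M v) + q v * ?d v)"
      using sum(2) q0 by (simp add: local_entropy_def)
    also have "\<dots> \<le> local_entropy V h"
      unfolding local_entropy_def
    proof (rule set_integral_mono[OF sum(1) hent])
      fix v assume "v \<in> ?D"
      then have "h v \<ge> 0" using h by (auto simp: entropic_def)
      then show "ent_density (?M v) + q v * ?d v \<le> ent_density (h v)"
        using ent_density_tangent[OF _ pos] by (simp add: q)
    qed
    finally show ?thesis .
  qed
qed

text \<open>
  The relation for \<open>h\<close> is implicit, so \<open>S[M]\<close> must be compared with \<open>S[h]\<close> and not with \<open>S[g]\<close>: the
  comparison \<open>S[M] \<le> S[h]\<close> contributes \<open>l * S[h]\<close> on the right, which is absorbed on the left.
  No bound on \<open>l\<close> is involved, hence the stability is uniform in the stiffness.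
\<close>

lemma relaxation_entropy:
  assumes g: "entropic V g" and M: "has_maxwellian {-V..V} h" and "l \<ge> 0"
    and h: "\<And>v. v \<in> {-V..V} \<Longrightarrow> h v = g v + l * (local_maxwellian {-V..V} h v - h v)"
  shows "entropic V h" and "local_entropy V h \<le> local_entropy V g"
proof -
  obtain \<rho> u T where p: "(SOME p. maxwellian_moments {-V..V} h p) = (\<rho>, u, T)"
    by (metis prod_cases3)
  have mom: "maxwellian_moments {-V..V} h (\<rho>, u, T)"
    using M p unfolding has_maxwellian_def by (metis someI)
  have M: "local_maxwellian {-V..V} h = maxwellian \<rho> u T"
    by (simp add: local_maxwellian_def p)
  have Me: "entropic V (maxwellian \<rho> u T)"
    using mom by (intro entropic_maxwellian) (auto simp: maxwellian_moments_def)
  define f where "f = (\<lambda>b. if b then g else maxwellian \<rho> u T)"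
  define c where "c = (\<lambda>b. if b then 1 / (1 + l) else l / (1 + l))"
  have f: "entropic V (f b)" for b using g Me by (simp add: f_def)
  have c: "c b \<ge> 0" for b using \<open>l \<ge> 0\<close> by (simp add: c_def)
  have c1: "sum c UNIV = 1" using \<open>l \<ge> 0\<close> by (simp add: UNIV_bool c_def field_simps)
  have comb: "h v = (\<Sum>b\<in>UNIV. c b * f b v)" if "v \<in> {-V..V}" for v
  proof -
    have "(1 + l) * h v = g v + l * maxwellian \<rho> u T v"
      using h[OF that] by (simp add: M algebra_simps)
    then have "h v = (g v + l * maxwellian \<rho> u T v) / (1 + l)"
      using \<open>l \<ge> 0\<close> by (simp add: eq_divide_eq mult.commute)
    then show ?thesis by (simp add: UNIV_bool c_def f_def add_divide_distrib)
  qed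
  note cc = entropic_constant_combination[OF finite f c c1 comb]
  show he: "entropic V h" by (rule cc(1))
  have "(1 + l) * local_entropy V h \<le> local_entropy V g + l * local_entropy V (maxwellian \<rho> u T)"
  proof -
    have "local_entropy V h \<le> (local_entropy V g + l * local_entropy V (maxwellian \<rho> u T)) / (1 + l)"
      using cc(2) by (simp add: UNIV_bool c_def f_def add_divide_distrib)
    then show ?thesis using \<open>l \<ge> 0\<close> by (simp add: pos_le_divide_eq mult.commute)
  qed
  also have "\<dots> \<le> local_entropy V g + l * local_entropy V h"
    using maxwellian_minimizes_entropy[OF he mom] \<open>l \<ge> 0\<close> by (intro add_left_mono mult_left_mono)
  finally show "local_entropy V h \<le> local_entropy V g" by (simp add: algebra_simps)
qed

section \<open>The upwind step\<close>

text \<open>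
  Both boundary conditions allow the sums over the grid to be taken over a window \<open>{p..<q}\<close> at whose
  two ends the grid function takes the same values: one period in the periodic case, and in the
  compactly supported case an interval so large that these values are zero.  The two equations make sums
  over the window invariant under a shift by one cell to the right and to the left.
\<close>

definition closed_window :: "int \<Rightarrow> int \<Rightarrow> real \<Rightarrow> (int \<Rightarrow> real \<Rightarrow> real) \<Rightarrow> bool" where
  "closed_window p q V g \<longleftrightarrow> p \<le> q \<and>
     (\<forall>v\<in>{-V..V}. g p v = g q v \<and> g (p - 1) v = g (q - 1) v)"

lemma sum_shift_window:
  fixes s :: "int \<Rightarrow> real"
  assumes "p \<le> q" "s p = s q"
  shows "(\<Sum>k\<in>{p..<q}. s (k + 1)) = (\<Sum>k\<in>{p..<q}. s k)"
proof (cases "p = q")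
  case False
  have "(\<Sum>k\<in>{p..<q}. s (k + 1)) = (\<Sum>k\<in>{p + 1..<q + 1}. s k)"
    by (rule sum.reindex_bij_witness[of _ "\<lambda>k. k - 1" "\<lambda>k. k + 1"]) auto
  also have "{p + 1..<q + 1} = insert q ({p..<q} - {p})" using assms False by auto
  also have "(\<Sum>k\<in>\<dots>. s k) = s q + (\<Sum>k\<in>{p..<q} - {p}. s k)" by simp
  also have "\<dots> = (\<Sum>k\<in>{p..<q}. s k)"
    using assms False by (simp add: sum.remove[of "{p..<q}" p])
  finally show ?thesis .
qed simp

text \<open>
  With \<open>\<theta> = \<tau> / dx\<close>, the step is the convex combination of \<open>g k\<close>, \<open>g (k - 1)\<close> and \<open>g (k + 1)\<close> with
  weights \<open>1 - \<theta> * \<bar>v\<bar>\<close>, \<open>\<theta> * max v 0\<close> and \<open>\<theta> * max (- v) 0\<close>.  The weights do not depend on \<open>k\<close>, so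
  after summation over the grid the three entropy terms coincide and the weights add up to one.
\<close>

lemma upwind_entropy:
  assumes "dx > 0" "V > 0" "\<tau> \<ge> 0" and cfl: "\<tau> * V \<le> dx"
    and g: "\<And>k. entropic V (g k)" and win: "closed_window p q V g"
  defines "h \<equiv> \<lambda>k v. g k v - \<tau> * upwind dx g k v"
  shows "entropic V (h k)"
    and "(\<Sum>k\<in>{p..<q}. local_entropy V (h k)) \<le> (\<Sum>k\<in>{p..<q}. local_entropy V (g k))"
proof -
  let ?D = "{-V..V}" and ?I = "{-1, 0, 1} :: int set"
  define w where "w = (\<lambda>d v. if d = 0 then 1 - \<tau> / dx * \<bar>v\<bar>
      else \<tau> / dx * (if d = (-1::int) then max v 0 else max (- v) 0))"
  have w_meas: "w d \<in> borel_measurable borel" for d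
    unfolding w_def by measurable
  have "\<tau> / dx * \<bar>v\<bar> \<le> 1" if "v \<in> ?D" for v
  proof -
    have "\<tau> / dx * \<bar>v\<bar> \<le> \<tau> / dx * V" using that assms by (intro mult_left_mono) auto
    also have "\<dots> \<le> 1" using cfl \<open>dx > 0\<close> by (simp add: field_simps)
    finally show ?thesis .
  qed
  then have w: "w d v \<ge> 0" if "v \<in> ?D" for d v
    using that \<open>\<tau> \<ge> 0\<close> \<open>dx > 0\<close> by (auto simp: w_def)
  have w1: "(\<Sum>d\<in>?I. w d v) = 1" for v
    using \<open>dx > 0\<close> by (simp add: w_def max_def abs_if)
  have comb: "h k v = (\<Sum>d\<in>?I. w d v * g (k + d) v)" for k v
    using \<open>dx > 0\<close> by (simp add: w_def h_def upwind_def max_def abs_if field_simps)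
  note cc = entropic_convex_combination[where I = ?I and w = w and V = V, OF _ g w_meas w w1 comb, simplified]
  show "entropic V (h k)" for k by (rule cc(1))
  let ?e = "\<lambda>k v. ent_density (g k v)"
  have ei: "set_integrable lborel ?D (?e k)" for k using g by (simp add: entropic_def)
  have shift: "(\<Sum>k\<in>{p..<q}. ?e (k + d) v) = (\<Sum>k\<in>{p..<q}. ?e k v)" if "v \<in> ?D" "d \<in> ?I" for d v
    using sum_shift_window[of p q "\<lambda>k. ?e k v"] sum_shift_window[of p q "\<lambda>k. ?e (k - 1) v"] that win
    by (auto simp: closed_window_def)
  have ii: "set_integrable lborel ?D (\<lambda>v. w d v * ?e (k + d) v)" if "d \<in> ?I" for k d
    using cc(2)[of d k] that by auto
  have "(\<Sum>k\<in>{p..<q}. local_entropy V (h k))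
      \<le> (\<Sum>k\<in>{p..<q}. \<Sum>d\<in>?I. LINT v:?D|lborel. w d v * ?e (k + d) v)"
    using cc(3) by (intro sum_mono) simp
  also have "\<dots> = (\<Sum>k\<in>{p..<q}. LINT v:?D|lborel. (\<Sum>d\<in>?I. w d v * ?e (k + d) v))"
    using ii by (intro sum.cong refl set_integral_sum(2)[symmetric]) auto
  also have "\<dots> = (LINT v:?D|lborel. (\<Sum>k\<in>{p..<q}. \<Sum>d\<in>?I. w d v * ?e (k + d) v))"
    using ii by (intro set_integral_sum(2)[symmetric] set_integral_sum(1)) auto
  also have "\<dots> = (LINT v:?D|lborel. (\<Sum>k\<in>{p..<q}. ?e k v))"
  proof (rule set_lebesgue_integral_cong)
    show "\<forall>v. v \<in> ?D \<longrightarrow> (\<Sum>k\<in>{p..<q}. \<Sum>d\<in>?I. w d v * ?e (k + d) v) = (\<Sum>k\<in>{p..<q}. ?e k v)"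
    proof (intro allI impI)
      fix v assume v: "v \<in> ?D"
      have "(\<Sum>k\<in>{p..<q}. \<Sum>d\<in>?I. w d v * ?e (k + d) v) = (\<Sum>d\<in>?I. w d v * (\<Sum>k\<in>{p..<q}. ?e (k + d) v))"
        by (subst sum.swap) (simp only: sum_distrib_left)
      also have "\<dots> = (\<Sum>d\<in>?I. w d v * (\<Sum>k\<in>{p..<q}. ?e k v))"
        using shift[OF v] by (intro sum.cong) auto
      also have "\<dots> = (\<Sum>k\<in>{p..<q}. ?e k v)"
        by (simp only: sum_distrib_right[symmetric] w1 mult_1_left)
      finally show "(\<Sum>k\<in>{p..<q}. \<Sum>d\<in>?I. w d v * ?e (k + d) v) = (\<Sum>k\<in>{p..<q}. ?e k v)" .
    qed
  qed simp
  also have "\<dots> = (\<Sum>k\<in>{p..<q}. local_entropy V (g k))"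
    unfolding local_entropy_def using ei by (intro set_integral_sum(2)) auto
  finally show "(\<Sum>k\<in>{p..<q}. local_entropy V (h k)) \<le> (\<Sum>k\<in>{p..<q}. local_entropy V (g k))" .
qed

section \<open>Stages in convex form\<close>

text \<open>
  The weight \<open>c i j\<close> belongs to the upwind step of length \<open>dt * d i j / c i j\<close> applied to \<open>F j\<close>.  The
  inequality between \<open>d\<close> and \<open>c\<close> is the CFL condition of that step, multiplied by \<open>c i j\<close> so that it also
  makes sense (and forces \<open>dt * d i j = 0\<close>) when \<open>c i j = 0\<close>.
\<close>

lemma convex_stages_entropy:
  fixes z l :: "nat \<Rightarrow> real" and c d :: "nat \<Rightarrow> nat \<Rightarrow> real"
  assumes "dx > 0" "V > 0" "dt \<ge> 0"
    and fn: "\<And>k. entropic V (fn k)"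
    and win: "\<And>i. i \<in> {1..\<nu>} \<Longrightarrow> closed_window p q V (F i)"
    and M: "\<And>i k. i \<in> {1..\<nu>} \<Longrightarrow> has_maxwellian {-V..V} (F i k)"
    and z: "\<And>i. i \<in> {1..\<nu>} \<Longrightarrow> z i \<ge> 0" and l: "\<And>i. i \<in> {1..\<nu>} \<Longrightarrow> l i \<ge> 0"
    and c: "\<And>i j. i \<in> {1..\<nu>} \<Longrightarrow> j \<in> {1..<i} \<Longrightarrow> c i j \<ge> 0"
    and d: "\<And>i j. i \<in> {1..\<nu>} \<Longrightarrow> j \<in> {1..<i} \<Longrightarrow> d i j \<ge> 0"
    and cfl: "\<And>i j. i \<in> {1..\<nu>} \<Longrightarrow> j \<in> {1..<i} \<Longrightarrow> dt * d i j * V \<le> c i j * dx"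
    and one: "\<And>i. i \<in> {1..\<nu>} \<Longrightarrow> z i + (\<Sum>j\<in>{1..<i}. c i j) = 1"
    and stage: "\<And>i k v. i \<in> {1..\<nu>} \<Longrightarrow> v \<in> {-V..V} \<Longrightarrow>
      F i k v = z i * fn k v + (\<Sum>j\<in>{1..<i}. c i j * F j k v - d i j * (dt * upwind dx (F j) k v))
        + l i * (local_maxwellian {-V..V} (F i k) v - F i k v)"
    and "i \<in> {1..\<nu>}"
  shows "(\<forall>k. entropic V (F i k)) \<and>
    (\<Sum>k\<in>{p..<q}. local_entropy V (F i k)) \<le> (\<Sum>k\<in>{p..<q}. local_entropy V (fn k))"
  using \<open>i \<in> {1..\<nu>}\<close>
proof (induction i rule: less_induct)
  case (less i)
  let ?S = "\<lambda>g. \<Sum>k\<in>{p..<q}. local_entropy V (g k)"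
  have IH: "entropic V (F j k)" "?S (F j) \<le> ?S fn" if "j \<in> {1..<i}" for j k
    using less.IH[of j] less.prems that by auto
  \<comment> \<open>If \<open>c i j = 0\<close>, division by zero gives the step length zero, which is the right one.\<close>
  define \<tau> where "\<tau> = (\<lambda>j. dt * d i j / c i j)"
  have \<tau>: "\<tau> j \<ge> 0" "\<tau> j * V \<le> dx" "c i j * \<tau> j = dt * d i j" if j: "j \<in> {1..<i}" for j
  proof -
    have "c i j \<ge> 0" "d i j \<ge> 0" "dt * d i j * V \<le> c i j * dx"
      using c d cfl less.prems j by auto
    moreover have "dt * d i j = 0" if "c i j = 0"
      using calculation that \<open>V > 0\<close> \<open>dt \<ge> 0\<close> by (simp add: mult_le_0_iff zero_le_mult_iff) fastforce
    ultimately show "\<tau> j \<ge> 0" "\<tau> j * V \<le> dx" "c i j * \<tau> j = dt * d i j"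
      using \<open>dt \<ge> 0\<close> \<open>dx > 0\<close> unfolding \<tau>_def
      by (cases "c i j = 0"; simp add: field_simps)+
  qed
  \<comment> \<open>Index \<open>0\<close> stands for \<open>fn\<close>.\<close>
  define h where "h = (\<lambda>j k v. if j = 0 then fn k v else F j k v - \<tau> j * upwind dx (F j) k v)"
  define w where "w = (\<lambda>j. if j = 0 then z i else c i j)"
  have h: "entropic V (h j k) \<and> ?S (h j) \<le> ?S fn" if "j \<in> {0..<i}" for j k
  proof (cases "j = 0")
    case True
    then show ?thesis using fn by (simp add: h_def)
  next
    case False
    then have j: "j \<in> {1..<i}" "j \<in> {1..\<nu>}" using that less.prems by auto
    note up = upwind_entropy[OF \<open>dx > 0\<close> \<open>V > 0\<close> \<tau>(1,2)[OF j(1)] IH(1)[OF j(1)] win[OF j(2)]]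
    show ?thesis using up IH(2)[OF j(1)] False by (simp add: h_def)
  qed
  have w: "w j \<ge> 0" if "j \<in> {0..<i}" for j
    using that z c less.prems by (auto simp: w_def)
  have split: "(\<Sum>j\<in>{0..<i}. f j) = f 0 + (\<Sum>j\<in>{1..<i}. f j)" for f :: "nat \<Rightarrow> real"
    using less.prems by (simp add: sum.atLeast_Suc_lessThan)
  have w1: "sum w {0..<i} = 1"
    using one[OF less.prems] unfolding split by (simp add: w_def)
  define G where "G = (\<lambda>k v. \<Sum>j\<in>{0..<i}. w j * h j k v)"
  have G: "entropic V (G k)" "local_entropy V (G k) \<le> (\<Sum>j\<in>{0..<i}. w j * local_entropy V (h j k))" for k
    using entropic_constant_combination[of "{0..<i}" V "\<lambda>j. h j k" w "G k"] h w w1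
    by (auto simp: G_def)
  have Gv: "G k v = z i * fn k v + (\<Sum>j\<in>{1..<i}. c i j * F j k v - d i j * (dt * upwind dx (F j) k v))" for k v
  proof -
    have "w j * h j k v = c i j * F j k v - d i j * (dt * upwind dx (F j) k v)" if "j \<in> {1..<i}" for j
    proof -
      have "w j * h j k v = c i j * F j k v - (c i j * \<tau> j) * upwind dx (F j) k v"
        using that by (simp add: w_def h_def algebra_simps)
      then show ?thesis unfolding \<tau>(3)[OF that] by simp
    qed
    then show ?thesis unfolding G_def split by (simp add: w_def h_def)
  qed
  have rel: "entropic V (F i k)" "local_entropy V (F i k) \<le> local_entropy V (G k)" for k
    using relaxation_entropy[OF G(1)[of k] M[OF less.prems, of k] l[OF less.prems]]
      stage[OF less.prems] Gv by auto
  have "?S (F i) \<le> ?S G" by (intro sum_mono rel)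
  also have "\<dots> \<le> (\<Sum>k\<in>{p..<q}. \<Sum>j\<in>{0..<i}. w j * local_entropy V (h j k))"
    by (intro sum_mono G)
  also have "\<dots> = (\<Sum>j\<in>{0..<i}. w j * ?S (h j))"
    by (subst sum.swap) (simp only: sum_distrib_left)
  also have "\<dots> \<le> (\<Sum>j\<in>{0..<i}. w j * ?S fn)"
    by (rule sum_mono, rule mult_left_mono) (use h w in blast)+
  also have "\<dots> = ?S fn" by (simp only: sum_distrib_right[symmetric] w1 mult_1_left)
  finally show ?case using rel(1) by blast
qed

section \<open>From the tableau to convex form\<close>

text \<open>
  Forward substitution in the triangular system formed by the stages \<open>p\<close> to \<open>\<nu>\<close>: the coefficients \<open>b\<close>
  are the entries of the inverse of the implicit matrix, and \<open>b'\<close> those of minus this inverse times the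
  explicit matrix, so that \<open>Q i\<close> is a combination of \<open>y j - y0\<close> and \<open>t j\<close>.  Here \<open>y\<close>, \<open>t\<close> and \<open>Q\<close> stand for
  the stage values, transport terms and collision terms at one point \<open>(k, v)\<close>.  The number \<open>p\<close> is the first
  implicit stage, \<open>1\<close> for type A and \<open>2\<close> for type ARS.  The bound \<open>p \<le> 2\<close> matters: the defining
  sums of \<open>b'\<close> start at \<open>j + 1\<close> for all \<open>j \<ge> 1\<close>, hence involve every stage from the second on.
\<close>

lemma stage_elimination:
  fixes a a' :: "nat \<Rightarrow> nat \<Rightarrow> real" and y0 :: real and y t Q :: "nat \<Rightarrow> real"
  assumes p: "1 \<le> p" "p \<le> 2"
    and diag: "\<And>i. i \<in> {p..\<nu>} \<Longrightarrow> a i i \<noteq> 0"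
    and stage: "\<And>i. i \<in> {p..\<nu>} \<Longrightarrow>
      y i = y0 - (\<Sum>j\<in>{1..<i}. a' i j * t j) + (\<Sum>j\<in>{p..i}. a i j * Q j)"
    and i: "i \<in> {p..\<nu>}"
  shows "y i = (1 - (\<Sum>j\<in>{p..<i}. coef_c a i j)) * y0 + (\<Sum>j\<in>{p..<i}. coef_c a i j * y j)
      - (\<Sum>j\<in>{1..<i}. coef_c' a a' i j * t j) + a i i * Q i"
proof -
  have main: "Q i = (\<Sum>j\<in>{p..i}. coef_b a i j * (y j - y0)) - (\<Sum>j\<in>{1..<i}. coef_b' a a' i j * t j) \<and>
    y i = y0 + (\<Sum>j\<in>{p..<i}. coef_c a i j * (y j - y0))
      - (\<Sum>j\<in>{1..<i}. coef_c' a a' i j * t j) + a i i * Q i" if "i \<in> {p..\<nu>}" for i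
    using that
  proof (induction i rule: less_induct)
    case (less i)
    have ne: "a i i \<noteq> 0" using diag less.prems by blast
    have "(\<Sum>l\<in>{p..<i}. a i l * Q l) = (\<Sum>l\<in>{p..<i}. a i l *
        ((\<Sum>j\<in>{p..l}. coef_b a l j * (y j - y0)) - (\<Sum>j\<in>{1..<l}. coef_b' a a' l j * t j)))"
    proof (rule sum.cong)
      fix l assume "l \<in> {p..<i}"
      then have "l < i" "l \<in> {p..\<nu>}" using less.prems by auto
      then show "a i l * Q l = a i l *
          ((\<Sum>j\<in>{p..l}. coef_b a l j * (y j - y0)) - (\<Sum>j\<in>{1..<l}. coef_b' a a' l j * t j))"
        using less.IH[of l] by metis
    qed simp
    also have "\<dots> = (\<Sum>l\<in>{p..<i}. \<Sum>j\<in>{p..l}. a i l * coef_b a l j * (y j - y0))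
        - (\<Sum>l\<in>{p..<i}. \<Sum>j\<in>{1..<l}. a i l * coef_b' a a' l j * t j)"
      by (simp add: right_diff_distrib sum_subtractf sum_distrib_left mult.assoc)
    \<comment> \<open>Exchanging the sums over the triangles produces the coefficients \<open>c\<close> and \<open>c'\<close>.\<close>
    also have "(\<Sum>l\<in>{p..<i}. \<Sum>j\<in>{p..l}. a i l * coef_b a l j * (y j - y0))
        = (\<Sum>j\<in>{p..<i}. \<Sum>l\<in>{j..<i}. a i l * coef_b a l j * (y j - y0))"
      unfolding sum.Sigma[OF finite_atLeastLessThan ballI[OF finite_atLeastAtMost]]
        sum.Sigma[OF finite_atLeastLessThan ballI[OF finite_atLeastLessThan]]
      by (rule sum.reindex_bij_witness[of _ "\<lambda>(x, y). (y, x)" "\<lambda>(x, y). (y, x)"]) auto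
    also have "\<dots> = (\<Sum>j\<in>{p..<i}. coef_c a i j * (y j - y0))"
      by (simp add: coef_c_def sum_distrib_right)
    also have "(\<Sum>l\<in>{p..<i}. \<Sum>j\<in>{1..<l}. a i l * coef_b' a a' l j * t j)
        = (\<Sum>j\<in>{1..<i}. \<Sum>l\<in>{j<..<i}. a i l * coef_b' a a' l j * t j)"
      unfolding sum.Sigma[OF finite_atLeastLessThan ballI[OF finite_greaterThanLessThan]]
        sum.Sigma[OF finite_atLeastLessThan ballI[OF finite_atLeastLessThan]]
      by (rule sum.reindex_bij_witness[of _ "\<lambda>(x, y). (y, x)" "\<lambda>(x, y). (y, x)"]) (use p in auto)
    also have "\<dots> = (\<Sum>j\<in>{1..<i}. coef_c' a a' i j * t j) - (\<Sum>j\<in>{1..<i}. a' i j * t j)"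
      by (simp add: coef_c'_def sum_distrib_right distrib_right sum.distrib)
    finally have low: "(\<Sum>l\<in>{p..<i}. a i l * Q l) = (\<Sum>j\<in>{p..<i}. coef_c a i j * (y j - y0))
        - ((\<Sum>j\<in>{1..<i}. coef_c' a a' i j * t j) - (\<Sum>j\<in>{1..<i}. a' i j * t j))" .
    have "{p..i} = insert i {p..<i}" using less.prems by auto
    then have split: "(\<Sum>j\<in>{p..i}. f j) = f i + (\<Sum>j\<in>{p..<i}. f j)" for f :: "nat \<Rightarrow> real"
      by simp
    have yi: "y i = y0 + (\<Sum>j\<in>{p..<i}. coef_c a i j * (y j - y0))
        - (\<Sum>j\<in>{1..<i}. coef_c' a a' i j * t j) + a i i * Q i"
      using stage[OF less.prems] unfolding split low by simp
    have b: "coef_b a i j = - coef_c a i j / a i i" if "j \<in> {p..<i}" for j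
      using that by (subst coef_b.simps) (simp add: coef_c_def)
    have b': "coef_b' a a' i j = - coef_c' a a' i j / a i i" if "j \<in> {1..<i}" for j
      using that by (subst coef_b'.simps) (simp add: coef_c'_def field_simps)
    have bii: "coef_b a i i = 1 / a i i" by (subst coef_b.simps) simp
    have 1: "(\<Sum>j\<in>{p..<i}. coef_b a i j * (y j - y0)) = - (\<Sum>j\<in>{p..<i}. coef_c a i j * (y j - y0)) / a i i"
      using b by (simp add: sum_divide_distrib sum_negf[symmetric])
    have 2: "(\<Sum>j\<in>{1..<i}. coef_b' a a' i j * t j) = - (\<Sum>j\<in>{1..<i}. coef_c' a a' i j * t j) / a i i"
      using b' by (simp add: sum_divide_distrib sum_negf[symmetric])
    have "Q i = (y i - y0 - (\<Sum>j\<in>{p..<i}. coef_c a i j * (y j - y0))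
        + (\<Sum>j\<in>{1..<i}. coef_c' a a' i j * t j)) / a i i"
      using yi ne by (simp add: field_simps)
    then have "Q i = (\<Sum>j\<in>{p..i}. coef_b a i j * (y j - y0)) - (\<Sum>j\<in>{1..<i}. coef_b' a a' i j * t j)"
      unfolding split 1 2 bii by (simp add: add_divide_distrib diff_divide_distrib)
    then show ?case using yi by blast
  qed
  have "(\<Sum>j\<in>{p..<i}. coef_c a i j * (y j - y0))
      = (\<Sum>j\<in>{p..<i}. coef_c a i j * y j) - (\<Sum>j\<in>{p..<i}. coef_c a i j) * y0"
    by (simp add: right_diff_distrib sum_subtractf sum_distrib_right)
  then show ?thesis using conjunct2[OF main[OF i]] by (simp add: left_diff_distrib)
qed

lemma cfl_of_ratio:
  assumes "dx > 0" "V > 0" "x \<ge> 0" "y \<ge> 0"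
    and cfl: "ereal dt \<le> c * ereal (dx / V)" and c: "c \<le> ratio x y"
  shows "dt * y * V \<le> x * dx"
proof (cases "y = 0")
  case True
  then show ?thesis using assms by simp
next
  case False
  have "ereal dt \<le> ratio x y * ereal (dx / V)"
    using cfl ereal_mult_right_mono[OF c, of "ereal (dx / V)"] assms by (auto intro: order_trans)
  then have "dt \<le> x / y * (dx / V)" using False by (simp add: ratio_def)
  then show ?thesis using assms False by (simp add: field_simps)
qed

section \<open>The discrete entropy inequality\<close>

text \<open>
  One window has to serve all stages at once, since the cells counted in the total entropy of a
  compactly supported grid function depend on that function.
\<close>

lemma ex_closed_window:
  assumes "finite A" "\<And>g. g \<in> A \<Longrightarrow> satisfies_bc bc V g"
  obtains p q where "\<And>g. g \<in> A \<Longrightarrow> closed_window p q V g"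
    and "\<And>g. g \<in> A \<Longrightarrow> total_entropy bc V dx g = dx * (\<Sum>k\<in>{p..<q}. local_entropy V (g k))"
proof (cases bc)
  case (Periodic N)
  show ?thesis
  proof (rule that[of 0 "int N"])
    fix g assume "g \<in> A"
    then have per: "g (k + int N) v = g k v" if "v \<in> {-V..V}" for k v
      using assms Periodic that by auto
    show "closed_window 0 (int N) V g"
      using per[of _ 0] per[of _ "-1"] by (simp add: closed_window_def)
    show "total_entropy bc V dx g = dx * (\<Sum>k\<in>{0..<int N}. local_entropy V (g k))"
      by (simp add: total_entropy_def Periodic)
  qed
next
  case Compact_support
  define S where "S = (\<Union>g\<in>A. {k. \<exists>v\<in>{-V..V}. g k v \<noteq> 0})"
  have "finite S" unfolding S_def using assms Compact_support by auto
  then have "finite (abs ` S)" by simp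
  then obtain L where L: "\<And>k. k \<in> S \<Longrightarrow> \<bar>k\<bar> \<le> L"
    by (metis bdd_above_finite bdd_above.E image_eqI)
  \<comment> \<open>The window reaches far enough for \<open>-R - 1\<close>, \<open>-R\<close>, \<open>R - 1\<close> and \<open>R\<close> to be outside all supports.\<close>
  define R where "R = max L 0 + 2"
  have LR: "\<bar>k\<bar> < R - 1" if "k \<in> S" for k using L[OF that] by (simp add: R_def)
  have "R > 0" by (simp add: R_def)
  show ?thesis
  proof (rule that[of "-R" R])
    fix g assume g: "g \<in> A"
    have z: "g k v = 0" if "v \<in> {-V..V}" "\<not> \<bar>k\<bar> < R - 1" for k v
      using LR[of k] that g unfolding S_def by blast
    show "closed_window (-R) R V g"
      using z \<open>R > 0\<close> by (simp add: closed_window_def)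
    let ?C = "{k. \<exists>v\<in>{-V..V}. g k v \<noteq> 0}"
    have "(\<Sum>k\<in>?C. local_entropy V (g k)) = (\<Sum>k\<in>{-R..<R}. local_entropy V (g k))"
    proof (rule sum.mono_neutral_left)
      show "?C \<subseteq> {-R..<R}" using z by force
      show "\<forall>k\<in>{-R..<R} - ?C. local_entropy V (g k) = 0"
      proof
        fix k assume "k \<in> {-R..<R} - ?C"
        then have "local_entropy V (g k) = (LINT v:{-V..V}|lborel. 0)"
          unfolding local_entropy_def by (intro set_lebesgue_integral_cong) auto
        then show "local_entropy V (g k) = 0" by simp
      qed
    qed simp
    then show "total_entropy bc V dx g = dx * (\<Sum>k\<in>{-R..<R}. local_entropy V (g k))"
      by (simp add: total_entropy_def Compact_support)
  qed
qed

theorem mainTheorem6: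
  fixes \<nu> :: nat
    and a a' :: "nat \<Rightarrow> nat \<Rightarrow> real" and w w' :: "nat \<Rightarrow> real"
    and \<alpha> \<epsilon> dt dx V :: real and c :: ereal
    and bc :: boundary
    and fn fn1 :: "int \<Rightarrow> real \<Rightarrow> real" and F :: "nat \<Rightarrow> int \<Rightarrow> real \<Rightarrow> real"
  assumes "\<nu> \<ge> 1" and "\<alpha> \<ge> 0" and "\<epsilon> > 0" and "dt > 0" and "dx > 0" and "V > 0"
    and "imex_tableau \<nu> a a'" and "gsa \<nu> a w a' w'"
    and "(type_A \<nu> a \<and> positivity_A \<nu> a a' \<and> c = c_sch_A \<nu> a a') \<or>
         (type_ARS \<nu> a w \<and> positivity_ARS \<nu> a a' \<and> c = c_sch_ARS \<nu> a a')"
    and CFL: "ereal dt \<le> c * ereal (dx / V)"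
    and nonneg: "\<And>k v. v \<in> {-V..V} \<Longrightarrow> fn k v \<ge> 0"
    and meas: "\<And>k. set_borel_measurable lborel {-V..V} (fn k)"
    and finite_entropy: "\<And>k. set_integrable lborel {-V..V} (\<lambda>v. ent_density (fn k v))"
    and "satisfies_bc bc V fn" and "satisfies_bc bc V fn1"
    and "\<And>i. i \<in> {1..\<nu>} \<Longrightarrow> satisfies_bc bc V (F i)"
    and "\<And>i k. i \<in> {1..\<nu>} \<Longrightarrow> has_maxwellian {-V..V} (F i k)"
    and "\<And>k. has_maxwellian {-V..V} (fn1 k)"
    and "imex_bgk_step \<nu> a a' \<alpha> \<epsilon> dt dx V fn F fn1"
  shows "total_entropy bc V dx fn1 \<le> total_entropy bc V dx fn"
proof -
  note bc = assms(14-16) and maxw = assms(17,18)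
  let ?D = "{-V..V}" and ?S = "\<lambda>p q g. \<Sum>k\<in>{p..<q}. local_entropy V (g k)"
  have fn: "entropic V (fn k)" for k
    using nonneg meas finite_entropy by (simp add: entropic_def)
  have stage: "F i k v = fn k v - (\<Sum>j\<in>{1..<i}. a' i j * (dt * upwind dx (F j) k v))
      + (\<Sum>j\<in>{1..i}. a i j * (dt / \<epsilon> * (local_maxwellian ?D (F j k) v - F j k v)))"
    if "i \<in> {1..\<nu>}" "v \<in> ?D" for i k v
    using assms(19) that unfolding imex_bgk_step_def by (simp add: sum_distrib_left ac_simps)
  have final: "fn1 k v = F \<nu> k v + \<alpha> * dt\<^sup>2 / \<epsilon>\<^sup>2 * (local_maxwellian ?D (fn1 k) v - fn1 k v)"
    if "v \<in> ?D" for k v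
    using assms(19) that unfolding imex_bgk_step_def by blast
  obtain p q where win: "\<And>g. g \<in> {fn, fn1} \<union> F ` {1..\<nu>} \<Longrightarrow> closed_window p q V g"
    and tot: "\<And>g. g \<in> {fn, fn1} \<union> F ` {1..\<nu>} \<Longrightarrow>
      total_entropy bc V dx g = dx * ?S p q g"
    using bc by (elim ex_closed_window[of "{fn, fn1} \<union> F ` {1..\<nu>}" bc V dx, rotated 2]) auto
  have "(\<forall>k. entropic V (F \<nu> k)) \<and> ?S p q (F \<nu>) \<le> ?S p q fn"
    using assms(9)
  proof
    assume A: "type_A \<nu> a \<and> positivity_A \<nu> a a' \<and> c = c_sch_A \<nu> a a'"
    then have pos: "\<And>i. i \<in> {1..\<nu>} \<Longrightarrow> a i i > 0 \<and> coef_c0_A a i \<ge> 0"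
      "\<And>i j. i \<in> {2..\<nu>} \<Longrightarrow> j \<in> {1..<i} \<Longrightarrow> coef_c a i j \<ge> 0 \<and> coef_c' a a' i j \<ge> 0"
      by (auto simp: positivity_A_def)
    have c0: "coef_c0_A a i = 1 - (\<Sum>j\<in>{1..<i}. coef_c a i j)" for i
      by (simp add: coef_c0_A_def coef_c_def)
    show ?thesis
    proof (rule convex_stages_entropy[where l = "\<lambda>i. a i i * (dt / \<epsilon>)" and z = "coef_c0_A a"
          and c = "coef_c a" and d = "coef_c' a a'" and F = F and \<nu> = \<nu> and fn = fn])
      fix i j assume ij: "i \<in> {1..\<nu>}" "j \<in> {1..<i}"
      then have i2: "i \<in> {2..\<nu>}" by auto
      show "coef_c a i j \<ge> 0" "coef_c' a a' i j \<ge> 0" using pos(2)[OF i2 ij(2)] by auto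
      moreover have "c \<le> ratio (coef_c a i j) (coef_c' a a' i j)"
        using A by (simp only: c_sch_A_def) (rule order_trans, rule INF_lower, rule i2, rule INF_lower, rule ij(2))
      ultimately show "dt * coef_c' a a' i j * V \<le> coef_c a i j * dx"
        using CFL assms by (intro cfl_of_ratio) auto
    next
      fix i k v assume i: "i \<in> {1..\<nu>}" and v: "v \<in> ?D"
      have "F i k v = (1 - (\<Sum>j\<in>{1..<i}. coef_c a i j)) * fn k v + (\<Sum>j\<in>{1..<i}. coef_c a i j * F j k v)
        - (\<Sum>j\<in>{1..<i}. coef_c' a a' i j * (dt * upwind dx (F j) k v))
        + a i i * (dt / \<epsilon> * (local_maxwellian ?D (F i k) v - F i k v))"
        by (rule stage_elimination[OF _ _ _ stage[OF _ v] i]) (use pos in fastforce)+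
      then show "F i k v = coef_c0_A a i * fn k v
        + (\<Sum>j\<in>{1..<i}. coef_c a i j * F j k v - coef_c' a a' i j * (dt * upwind dx (F j) k v))
        + a i i * (dt / \<epsilon>) * (local_maxwellian ?D (F i k) v - F i k v)"
        by (simp add: c0 sum_subtractf mult.assoc)
    qed (use assms fn win maxw pos c0 in \<open>auto intro!: mult_nonneg_nonneg less_imp_le\<close>)
  next
    assume R: "type_ARS \<nu> a w \<and> positivity_ARS \<nu> a a' \<and> c = c_sch_ARS \<nu> a a'"
    then have a1: "\<And>i. i \<in> {1..\<nu>} \<Longrightarrow> a i 1 = 0"
      and pos: "\<And>i. i \<in> {2..\<nu>} \<Longrightarrow> a i i > 0 \<and> coef_c0_ARS a i \<ge> 0 \<and> coef_c0'_ARS a a' i \<ge> 0"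
      "\<And>i j. i \<in> {3..\<nu>} \<Longrightarrow> j \<in> {2..<i} \<Longrightarrow> coef_c a i j \<ge> 0 \<and> coef_c' a a' i j \<ge> 0"
      by (auto simp: positivity_ARS_def type_ARS_def)
    have F1: "F 1 k v = fn k v" if "v \<in> ?D" for k v
      using stage[OF _ that, of 1 k] a1[of 1] \<open>\<nu> \<ge> 1\<close> by simp
    have c0: "coef_c0_ARS a i = 1 - (\<Sum>j\<in>{2..<i}. coef_c a i j)" for i
      by (simp add: coef_c0_ARS_def coef_c_def)
    have c0': "coef_c0'_ARS a a' i = coef_c' a a' i 1" for i
    proof -
      have "{2..<i} = {1<..<i}" by auto
      then show ?thesis by (simp only: coef_c0'_ARS_def coef_c'_def)
    qed
    \<comment> \<open>From the second stage on, the weight of \<open>fn\<close> moves to the index \<open>1\<close>, because \<open>F 1 = fn\<close>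
      comes with the transport term of weight \<open>coef_c0'_ARS\<close>.\<close>
    define c0R where "c0R = (\<lambda>i::nat. if i = 1 then 1 else 0 :: real)"
    define cR where "cR = (\<lambda>i j. if j = 1 then coef_c0_ARS a i else coef_c a i j)"
    have cd: "cR i j \<ge> 0 \<and> coef_c' a a' i j \<ge> 0 \<and> c \<le> ratio (cR i j) (coef_c' a a' i j)"
      if ij: "i \<in> {1..\<nu>}" "j \<in> {1..<i}" for i j
    proof (cases "j = 1")
      case True
      then have i: "i \<in> {2..\<nu>}" using ij by auto
      then have "c \<le> ratio (coef_c0_ARS a i) (coef_c0'_ARS a a' i)"
        using R by (simp only: c_sch_ARS_def)
          (rule min.coboundedI1, rule INF_lower, rule i)
      then show ?thesis using pos(1)[OF i] True by (simp add: cR_def c0')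
    next
      case False
      then have i: "i \<in> {3..\<nu>}" "j \<in> {2..<i}" using ij by auto
      then have "c \<le> ratio (coef_c a i j) (coef_c' a a' i j)"
        using R by (simp only: c_sch_ARS_def)
          (rule min.coboundedI2, rule order_trans, rule INF_lower, rule i(1),
           rule INF_lower, rule i(2))
      then show ?thesis using pos(2)[OF i] False by (simp add: cR_def)
    qed
    have head: "(\<Sum>j\<in>{1..<i}. f j) = f 1 + (\<Sum>j\<in>{2..<i}. f j)" if "i \<noteq> 1" "i \<in> {1..\<nu>}"
      for i and f :: "nat \<Rightarrow> real"
      using that by (simp add: sum.atLeast_Suc_lessThan numeral_2_eq_2)
    show ?thesis
    proof (rule convex_stages_entropy[where l = "\<lambda>i. a i i * (dt / \<epsilon>)" and z = c0R
          and c = cR and d = "coef_c' a a'" and F = F and \<nu> = \<nu> and fn = fn])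
      fix i j assume ij: "i \<in> {1..\<nu>}" "j \<in> {1..<i}"
      show "cR i j \<ge> 0" "coef_c' a a' i j \<ge> 0" using cd[OF ij] by auto
      then show "dt * coef_c' a a' i j * V \<le> cR i j * dx"
        using CFL assms cd[OF ij] by (intro cfl_of_ratio[where c = c]) auto
    next
      fix i assume i: "i \<in> {1..\<nu>}"
      show "c0R i \<ge> 0" by (simp add: c0R_def)
      show "0 \<le> a i i * (dt / \<epsilon>)"
        using pos(1)[of i] a1[of i] i assms(3,4) by (cases "i = 1") auto
      show "c0R i + (\<Sum>j\<in>{1..<i}. cR i j) = 1"
        using head[OF _ i] by (cases "i = 1") (auto simp: c0R_def cR_def c0)
    next
      fix i k v assume i: "i \<in> {1..\<nu>}" and v: "v \<in> ?D"
      show "F i k v = c0R i * fn k v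
        + (\<Sum>j\<in>{1..<i}. cR i j * F j k v - coef_c' a a' i j * (dt * upwind dx (F j) k v))
        + a i i * (dt / \<epsilon>) * (local_maxwellian ?D (F i k) v - F i k v)"
      proof (cases "i = 1")
        case True
        then show ?thesis using F1[OF v] a1[OF i] by (simp add: c0R_def)
      next
        case False
        have stage2: "F i k v = fn k v - (\<Sum>j\<in>{1..<i}. a' i j * (dt * upwind dx (F j) k v))
          + (\<Sum>j\<in>{2..i}. a i j * (dt / \<epsilon> * (local_maxwellian ?D (F j k) v - F j k v)))"
          if "i \<in> {2..\<nu>}" for i
        proof -
          have "{1..i} = insert 1 {2..i}" using that by auto
          then show ?thesis using stage[OF _ v, of i k] a1[of i] that by simp
        qed
        have "F i k v = (1 - (\<Sum>j\<in>{2..<i}. coef_c a i j)) * fn k v + (\<Sum>j\<in>{2..<i}. coef_c a i j * F j k v)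
          - (\<Sum>j\<in>{1..<i}. coef_c' a a' i j * (dt * upwind dx (F j) k v))
          + a i i * (dt / \<epsilon> * (local_maxwellian ?D (F i k) v - F i k v))"
          by (rule stage_elimination[OF _ _ _ stage2, where \<nu> = \<nu>]) (use pos i False in fastforce)+
        moreover have "(\<Sum>j\<in>{1..<i}. cR i j * F j k v)
            = coef_c0_ARS a i * fn k v + (\<Sum>j\<in>{2..<i}. coef_c a i j * F j k v)"
          using head[OF False i] F1[OF v] by (simp add: cR_def)
        ultimately show ?thesis
          using False by (simp only: c0R_def c0 sum_subtractf mult.assoc) simp
      qed
    qed (use assms fn win maxw in auto)
  qed
  then have Fnu: "\<And>k. entropic V (F \<nu> k)" "?S p q (F \<nu>) \<le> ?S p q fn" by auto
  have "local_entropy V (fn1 k) \<le> local_entropy V (F \<nu> k)" for k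
    using relaxation_entropy(2)[OF Fnu(1) maxw(2) _ final] \<open>\<alpha> \<ge> 0\<close> by simp
  then have "?S p q fn1 \<le> ?S p q fn"
    using Fnu(2) by (meson order_trans sum_mono)
  then show ?thesis using tot \<open>dx > 0\<close> by simp
qed

end
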